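(* Let $N\ge 1$, $d\in[0,1)$, let $P$ be a nonnegative $N\times N$ matrix each of whose columns sums to one, and let $V\in\mathbb{R}^N$ be a nonnegative vector whose entries sum to one. For $k\in\{1,\dots,N\}$ let $J_k$ be the $N\times N$ matrix whose only nonzero entry is $(J_k)_{kk}=1$, and let $I_d$ be the identity matrix. Let $(i_n)_{n\ge1}$ be a sequence with values in $\{1,\dots,N\}$. Define $$F_0=(1-d)V,\quad F_n=(I_d-J_{i_n}+dPJ_{i_n})F_{n-1}\ (n\ge1),\quad H_n=\sum_{k=1}^n J_{i_k}F_{k-1},$$ and $S_\infty=(1-d)\sum_{k=0}^{\infty}d^kP^kV$. Then for every $n\ge0$, $$S_\infty-H_n=\sum_{k=0}^{\infty}d^kP^kF_n=(I_d-dP)^{-1}F_n,$$ and consequently $$|S_\infty-H_n|=\frac{|F_n|}{1-d},$$ where $|\cdot|$ denotes the $L_1$ norm.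
   Context: $S_\infty$ equals $(1-d)(I_d-dP)^{-1}V$, the unique solution $X$ of $X=dPX+(1-d)V$ (the PageRank vector). *)

theory Defs
  imports "HOL-Analysis.Analysis"
begin

(* Powers with respect to the matrix product; the operator ^ on real^'n^'n is componentwise. *)
primrec matrix_power :: "real^'n^'n \<Rightarrow> nat \<Rightarrow> real^'n^'n" where
  "matrix_power A 0 = mat 1"
| "matrix_power A (Suc k) = A ** matrix_power A k"

definition l1_norm :: "real^'n \<Rightarrow> real" where
  "l1_norm x = (\<Sum>i\<in>UNIV. \<bar>x $ i\<bar>)"

definition J :: "'n \<Rightarrow> real^'n^'n" where
  "J k = (\<chi> a b. if a = k \<and> b = k then 1 else 0)"

(* The entry of row a and column b of P is P $ a $ b. *)
definition column_stochastic :: "real^'n^'n \<Rightarrow> bool" where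
  "column_stochastic P \<longleftrightarrow>
     (\<forall>a b. 0 \<le> P $ a $ b) \<and> (\<forall>b. (\<Sum>a\<in>UNIV. P $ a $ b) = 1)"

definition prob_vector :: "real^'n \<Rightarrow> bool" where
  "prob_vector V \<longleftrightarrow> (\<forall>a. 0 \<le> V $ a) \<and> (\<Sum>a\<in>UNIV. V $ a) = 1"

(* The index sequence i starts at 1; the value i 0 is never used. *)
primrec F :: "real \<Rightarrow> real^'n^'n \<Rightarrow> real^'n \<Rightarrow> (nat \<Rightarrow> 'n) \<Rightarrow> nat \<Rightarrow> real^'n" where
  "F d P V i 0 = (1 - d) *\<^sub>R V"
| "F d P V i (Suc n) =
     (mat 1 - J (i (Suc n)) + d *\<^sub>R (P ** J (i (Suc n)))) *v F d P V i n"

definition H :: "real \<Rightarrow> real^'n^'n \<Rightarrow> real^'n \<Rightarrow> (nat \<Rightarrow> 'n) \<Rightarrow> nat \<Rightarrow> real^'n" where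
  "H d P V i n = (\<Sum>k = 1..n. J (i k) *v F d P V i (k - 1))"

definition S_inf :: "real \<Rightarrow> real^'n^'n \<Rightarrow> real^'n \<Rightarrow> real^'n" where
  "S_inf d P V = (1 - d) *\<^sub>R (\<Sum>k. d ^ k *\<^sub>R (matrix_power P k *v V))"

end

theory Submission
  imports Defs
begin

text \<open>With A = I - dP, the invariant A (S - H_n) = F_n holds for n = 0 by the Neumann series and
  is preserved because F_(n+1) = F_n - A J F_n. A is invertible since P does not increase
  the L1 norm. All F_n are nonnegative, hence so is y = S - H_n; as P preserves the sum
  of the entries, y = F_n + d P y gives |y| = |F_n| + d |y|.\<close>

text \<open>Once the two sums are swapped, each \<open>x $ b\<close> is weighted by a column sum of
  \<open>P\<close>, which is 1.\<close>

lemma sum_column_stochastic_mult: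
  assumes "column_stochastic P"
  shows "(\<Sum>a\<in>UNIV. (P *v x) $ a) = (\<Sum>b\<in>UNIV. x $ b)"
proof -
  have "(\<Sum>a\<in>UNIV. (P *v x) $ a) = (\<Sum>b\<in>UNIV. \<Sum>a\<in>UNIV. P $ a $ b * x $ b)"
    by (simp add: matrix_vector_mult_def) (rule sum.swap)
  also have "\<dots> = (\<Sum>b\<in>UNIV. x $ b)"
    using assms by (simp add: sum_distrib_right[symmetric] column_stochastic_def)
  finally show ?thesis .
qed

lemma column_stochastic_mult_nonneg:
  assumes "column_stochastic P" and "\<And>a. 0 \<le> x $ a"
  shows "0 \<le> (P *v x) $ a"
  using assms by (auto simp: matrix_vector_mult_def column_stochastic_def intro!: sum_nonneg)

text \<open>Since the entries of \<open>P\<close> are nonnegative, the triangle inequality bounds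
  |Px| entrywise by P|x|, and \<open>P\<close> preserves the entry sum of |x|.\<close>

lemma l1_norm_column_stochastic_mult_le:
  assumes "column_stochastic P"
  shows "l1_norm (P *v x) \<le> l1_norm x"
proof -
  have "\<bar>(P *v x) $ a\<bar> \<le> (P *v (\<chi> b. \<bar>x $ b\<bar>)) $ a" for a
  proof -
    have "\<bar>(P *v x) $ a\<bar> \<le> (\<Sum>b\<in>UNIV. \<bar>P $ a $ b * x $ b\<bar>)"
      by (simp add: matrix_vector_mult_def)
    also have "\<dots> = (P *v (\<chi> b. \<bar>x $ b\<bar>)) $ a"
      using assms by (simp add: matrix_vector_mult_def abs_mult column_stochastic_def)
    finally show ?thesis .
  qed
  then have "l1_norm (P *v x) \<le> (\<Sum>a\<in>UNIV. (P *v (\<chi> b. \<bar>x $ b\<bar>)) $ a)"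
    unfolding l1_norm_def by (intro sum_mono)
  also have "\<dots> = l1_norm x"
    by (simp add: sum_column_stochastic_mult[OF assms] l1_norm_def)
  finally show ?thesis .
qed

text \<open>Links the Euclidean \<open>norm\<close>, in which series converge, to the L1 norm, in
  which \<open>P\<close> is nonexpansive.\<close>

lemma norm_le_l1_norm: "norm x \<le> l1_norm x"
  unfolding l1_norm_def by (rule norm_le_l1_cart)

lemma l1_norm_scaleR: "l1_norm (c *\<^sub>R x) = \<bar>c\<bar> * l1_norm x"
  by (simp add: l1_norm_def abs_mult sum_distrib_left)

lemma matrix_power_Suc_mult_vector: "matrix_power P (Suc k) *v x = P *v (matrix_power P k *v x)"
  by (simp add: matrix_vector_mul_assoc)

lemma l1_norm_matrix_power_mult_le:
  assumes "column_stochastic P"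
  shows "l1_norm (matrix_power P k *v x) \<le> l1_norm x"
proof (induction k)
  case (Suc k)
  then show ?case
    unfolding matrix_power_Suc_mult_vector
    using l1_norm_column_stochastic_mult_le[OF assms] order_trans by blast
qed simp

lemma matrix_power_mult_nonneg:
  assumes "column_stochastic P" and "\<And>a. 0 \<le> x $ a"
  shows "0 \<le> (matrix_power P k *v x) $ a"
proof (induction k arbitrary: a)
  case (Suc k)
  then show ?case
    unfolding matrix_power_Suc_mult_vector by (rule column_stochastic_mult_nonneg[OF assms(1)])
qed (simp add: assms)

text \<open>Powers of \<open>P\<close> do not increase the L1 norm, so a geometric series of ratio
  \<open>d\<close> dominates.\<close>

lemma summable_neumann_series:
  assumes "0 \<le> d" and "d < 1" and "column_stochastic P"
  shows "summable (\<lambda>k. d ^ k *\<^sub>R (matrix_power P k *v x))"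
proof (rule summable_comparison_test')
  show "summable (\<lambda>k. d ^ k * l1_norm x)"
    using assms by (intro summable_mult2 summable_geometric) simp
  show "norm (d ^ k *\<^sub>R (matrix_power P k *v x)) \<le> d ^ k * l1_norm x" for k
    using assms norm_le_l1_norm[of "matrix_power P k *v x"] l1_norm_matrix_power_mult_le[of P k x]
    by (auto intro!: mult_left_mono)
qed

lemma mat_minus_scaleR_mult_vector:
  fixes P :: "real^'n^'n"
  shows "(mat 1 - d *\<^sub>R P) *v x = x - d *\<^sub>R (P *v x)"
  by (simp add: matrix_vector_mult_diff_rdistrib scaleR_matrix_vector_assoc)

text \<open>Applying \<open>d *\<^sub>R P\<close> shifts the series by one index, so the difference
  leaves only the term \<open>k = 0\<close>, which is \<open>x\<close>.\<close>

lemma neumann_series_solves: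
  assumes "0 \<le> d" and "d < 1" and "column_stochastic P"
  shows "(mat 1 - d *\<^sub>R P) *v (\<Sum>k. d ^ k *\<^sub>R (matrix_power P k *v x)) = x"
proof -
  let ?g = "\<lambda>k. d ^ k *\<^sub>R (matrix_power P k *v x)"
  have s: "summable ?g"
    using assms by (rule summable_neumann_series)
  have "bounded_linear (\<lambda>y. d *\<^sub>R (P *v y))"
    by (intro bounded_linear_intros matrix_vector_mul_bounded_linear)
  then have "d *\<^sub>R (P *v suminf ?g) = (\<Sum>k. d *\<^sub>R (P *v ?g k))"
    using s by (rule bounded_linear.suminf)
  also have "\<dots> = (\<Sum>k. ?g (Suc k))"
    unfolding matrix_power_Suc_mult_vector by (simp add: matrix_vector_mult_scaleR)
  also have "\<dots> = suminf ?g - x"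
    using suminf_split_head[OF s] by simp
  finally show ?thesis
    by (simp add: mat_minus_scaleR_mult_vector)
qed

text \<open>The kernel is trivial: x = dPx forces |x| \<le> d|x| in the L1 norm, with d < 1. For a
  square matrix this suffices.\<close>

lemma invertible_mat_minus_scaleR_column_stochastic:
  assumes "0 \<le> d" and "d < 1" and "column_stochastic P"
  shows "invertible (mat 1 - d *\<^sub>R P)"
proof -
  have "x = 0" if "(mat 1 - d *\<^sub>R P) *v x = 0" for x
  proof -
    have "x = d *\<^sub>R (P *v x)"
      using that by (simp add: mat_minus_scaleR_mult_vector)
    then have "l1_norm x = d * l1_norm (P *v x)"
      using l1_norm_scaleR[of d "P *v x"] assms(1) by simp
    also have "\<dots> \<le> d * l1_norm x"
      using assms by (intro mult_left_mono l1_norm_column_stochastic_mult_le)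
    finally have "(1 - d) * l1_norm x \<le> 0"
      by (simp add: algebra_simps)
    then have "l1_norm x \<le> 0"
      using assms(2) by (simp add: mult_le_0_iff)
    then show "x = 0"
      using norm_le_l1_norm[of x] norm_le_zero_iff[of x] by linarith
  qed
  then show ?thesis
    by (metis invertible_left_inverse matrix_left_invertible_ker)
qed

lemma matrix_inv_mult_vector_eqI:
  fixes A :: "real^'n^'n"
  assumes "invertible A" and "A *v y = x"
  shows "matrix_inv A *v x = y"
proof -
  \<comment> \<open>\<open>matrix_inv\<close> is a Hilbert choice; invertibility supplies the
    witness that makes the chosen matrix a two-sided inverse.\<close>
  have "matrix_inv A ** A = mat 1"
    using someI_ex[OF assms(1)[unfolded invertible_def]] by (simp add: matrix_inv_def)
  then show ?thesis
    by (simp add: assms(2)[symmetric] matrix_vector_mul_assoc)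
qed

lemma J_mult_vector: "(J k *v x) $ a = (if a = k then x $ a else 0)"
proof -
  have "(J k *v x) $ a = (\<Sum>b\<in>UNIV. if b = k then (if a = k then x $ k else 0) else 0)"
    unfolding J_def matrix_vector_mult_def vec_lambda_beta by (rule sum.cong) auto
  then show ?thesis by simp
qed

text \<open>This grouping serves both later inductions: the first two terms erase one entry of F_n,
  and the two terms with \<open>J\<close> together are -(I - dP) J F_n.\<close>

lemma F_Suc_eq:
  "F d P V i (Suc n) = F d P V i n - J (i (Suc n)) *v F d P V i n
     + d *\<^sub>R (P *v (J (i (Suc n)) *v F d P V i n))"
  by (simp add: matrix_vector_mult_add_rdistrib matrix_vector_mult_diff_rdistrib
      scaleR_matrix_vector_assoc matrix_vector_mul_assoc)

text \<open>Each step sets one entry to zero and adds \<open>d\<close> times \<open>P\<close>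
  applied to the removed nonnegative part.\<close>

lemma F_nonneg:
  assumes "0 \<le> d" and "d < 1" and "column_stochastic P" and "prob_vector V"
  shows "0 \<le> F d P V i n $ a"
proof (induction n arbitrary: a)
  case 0
  then show ?case using assms by (simp add: prob_vector_def)
next
  case (Suc n)
  have "0 \<le> (P *v (J (i (Suc n)) *v F d P V i n)) $ a"
    by (rule column_stochastic_mult_nonneg[OF assms(3)]) (simp add: J_mult_vector Suc)
  then show ?case
    unfolding F_Suc_eq using Suc assms(1) by (simp add: J_mult_vector)
qed

lemma mult_S_inf_minus_H:
  assumes "0 \<le> d" and "d < 1" and "column_stochastic P"
  shows "(mat 1 - d *\<^sub>R P) *v (S_inf d P V - H d P V i n) = F d P V i n"
proof (induction n)
  case 0
  then show ?case
    by (simp add: S_inf_def H_def matrix_vector_mult_scaleR neumann_series_solves[OF assms])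
next
  case (Suc n)
  have "H d P V i (Suc n) = H d P V i n + J (i (Suc n)) *v F d P V i n"
    by (simp add: H_def)
  then have "(mat 1 - d *\<^sub>R P) *v (S_inf d P V - H d P V i (Suc n)) =
    (mat 1 - d *\<^sub>R P) *v (S_inf d P V - H d P V i n)
      - (mat 1 - d *\<^sub>R P) *v (J (i (Suc n)) *v F d P V i n)"
    by (simp add: matrix_vector_mult_diff_distrib[symmetric] algebra_simps)
  then show ?case
    \<comment> \<open>Only the product with J F_n is expanded, so that the induction hypothesis
      still matches the product with S - H_n.\<close>
    by (simp only: Suc F_Suc_eq mat_minus_scaleR_mult_vector[of d P "J (i (Suc n)) *v F d P V i n"])
      simp
qed

lemma l1_norm_neumann_series_nonneg:
  assumes "0 \<le> d" and "d < 1" and "column_stochastic P" and "\<And>a. 0 \<le> x $ a"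
  shows "l1_norm (\<Sum>k. d ^ k *\<^sub>R (matrix_power P k *v x)) = l1_norm x / (1 - d)"
proof -
  define y where "y = (\<Sum>k. d ^ k *\<^sub>R (matrix_power P k *v x))"
  have "0 \<le> y $ a" for a
  proof -
    have s: "summable (\<lambda>k. d ^ k *\<^sub>R (matrix_power P k *v x))"
      using assms(1-3) by (rule summable_neumann_series)
    \<comment> \<open>Coordinate projection is continuous and linear, so the sign of
      \<open>y\<close> can be read off termwise.\<close>
    have "y $ a = (\<Sum>k. (d ^ k *\<^sub>R (matrix_power P k *v x)) $ a)"
      unfolding y_def by (rule bounded_linear.suminf[OF bounded_linear_vec_nth s])
    moreover have "summable (\<lambda>k. (d ^ k *\<^sub>R (matrix_power P k *v x)) $ a)"
      by (rule bounded_linear.summable[OF bounded_linear_vec_nth s])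
    ultimately show ?thesis
      using assms by (auto intro!: suminf_nonneg mult_nonneg_nonneg matrix_power_mult_nonneg)
  qed
  then have y: "l1_norm y = (\<Sum>a\<in>UNIV. y $ a)"
    by (simp add: l1_norm_def)
  have "x = y - d *\<^sub>R (P *v y)"
    using neumann_series_solves[OF assms(1-3), of x]
    by (simp add: y_def mat_minus_scaleR_mult_vector)
  \<comment> \<open>Entry sums are linear, and for the nonnegative \<open>x\<close> and
    \<open>y\<close> they are the L1 norms; this gives an equality where the triangle inequality
    would give only a bound.\<close>
  then have "(\<Sum>a\<in>UNIV. x $ a) = (\<Sum>a\<in>UNIV. y $ a) - d * (\<Sum>a\<in>UNIV. (P *v y) $ a)"
    by (simp add: sum_subtractf sum_distrib_left)
  then have "l1_norm x = (1 - d) * l1_norm y"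
    using assms(4) y
    by (simp add: sum_column_stochastic_mult[OF assms(3)] l1_norm_def algebra_simps)
  then show ?thesis
    using assms(2) by (simp add: y_def)
qed

theorem theorem2:
  fixes d :: real and P :: "real^'n^'n" and V :: "real^'n" and i :: "nat \<Rightarrow> 'n"
  assumes "0 \<le> d" and "d < 1"
    and "column_stochastic P"
    and "prob_vector V"
  shows "summable (\<lambda>k. d ^ k *\<^sub>R (matrix_power P k *v V))
    \<and> invertible (mat 1 - d *\<^sub>R P)
    \<and> (\<forall>n. summable (\<lambda>k. d ^ k *\<^sub>R (matrix_power P k *v F d P V i n))
         \<and> S_inf d P V - H d P V i n = (\<Sum>k. d ^ k *\<^sub>R (matrix_power P k *v F d P V i n))
         \<and> (\<Sum>k. d ^ k *\<^sub>R (matrix_power P k *v F d P V i n))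
              = matrix_inv (mat 1 - d *\<^sub>R P) *v F d P V i n
         \<and> l1_norm (S_inf d P V - H d P V i n) = l1_norm (F d P V i n) / (1 - d))"
proof -
  note inv = invertible_mat_minus_scaleR_column_stochastic[OF assms(1-3)]
  have series: "(\<Sum>k. d ^ k *\<^sub>R (matrix_power P k *v F d P V i n))
      = matrix_inv (mat 1 - d *\<^sub>R P) *v F d P V i n" for n
    using matrix_inv_mult_vector_eqI[OF inv neumann_series_solves[OF assms(1-3)]] by simp
  \<comment> \<open>Both sides solve (I - dP) y = F_n, so both equal the inverse applied to
    F_n.\<close>
  have "S_inf d P V - H d P V i n = (\<Sum>k. d ^ k *\<^sub>R (matrix_power P k *v F d P V i n))" for n
    unfolding series
    using matrix_inv_mult_vector_eqI[OF inv mult_S_inf_minus_H[OF assms(1-3)]] by simp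
  then show ?thesis
    using summable_neumann_series[OF assms(1-3)] inv series
      l1_norm_neumann_series_nonneg[OF assms(1-3) F_nonneg[OF assms]]
    by metis
qed

end
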